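(* Let $B\in\mathbb{R}_{+}^{n\times n}$ be any matrix with $\mathrm{Tr}(B)\leq 1$ (all matrix operations are in max-algebra), and consider the problem of maximizing $x^{-}\mathbf{1}$ over all regular vectors $x\in\mathbb{R}_{+}^{n}$ subject to $Bx\leq x$ and $\mathbf{1}^{T}x=1$. Then the maximum value of the objective function is equal to $\|B^{\ast}(B^{\ast})^{-}\|$, and, writing $b_{1}^{\ast},\ldots,b_{n}^{\ast}$ for the columns of $B^{\ast}$, the minimal solutions are given by the set of normalized columns of $B^{\ast}$ of the form $$x=b_{k}^{\ast}\|b_{k}^{\ast}\|^{-1},\qquad k\in\arg\max_{1\leq j\leq n}\|b_{j}^{\ast}\|\,\|(b_{j}^{\ast})^{-}\|,$$ that is, each vector of this set is a solution of the problem, and every solution of the problem is entrywise greater than or equal to some vector of this set. If some vector of this set is entrywise less than or equal to all other vectors of the set, or is the only vector in the set, it uniquely determines the minimal solution of the problem (the solution $x_0$ such that $x_0\leq x$ for every solution $x$). Otherwise, the minimal solution is not uniquely defined (no such $x_0$ exists).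
   Context: Max-algebra: the set $\mathbb{R}_{+}$ of nonnegative reals with addition $a\oplus b=\max(a,b)$ and the usual multiplication. Matrices and vectors over $\mathbb{R}_+$ are added and multiplied by the usual rules with $+$ replaced by $\oplus$; inequalities are entrywise; $I$ is the usual identity matrix; $B^{0}=I$, $B^{p}=BB^{p-1}$ for integers $p\geq 1$. A vector is regular if it has no zero entries. $\mathbf{1}=(1,\ldots,1)^{T}$. For a nonzero matrix $A=(a_{ij})$, its conjugate $A^{-}=(a^{-}_{ij})$ is the matrix of transposed size with $a^{-}_{ij}=a_{ji}^{-1}$ if $a_{ji}\neq 0$ and $a^{-}_{ij}=0$ otherwise; for a nonzero column vector $x$ this gives the row vector $x^{-}$. Norms: $\|A\|=\max_{i,j}a_{ij}$ and $\|x\|=\max_{j}x_{j}$ (for row or column vectors). So $x^{-}\mathbf{1}=\max_i x_i^{-1}$ for regular $x$, and $\mathbf{1}^{T}x=\max_i x_i$. For $B=(b_{ij})\in\mathbb{R}_+^{n\times n}$: $\mathrm{tr}B=\bigoplus_{k=1}^{n}b_{kk}$ and $\mathrm{Tr}(B)=\bigoplus_{k=1}^{n}\mathrm{tr}B^{k}$. If $\mathrm{Tr}(B)\leq 1$, the Kleene star is $B^{\ast}=\bigoplus_{k=0}^{n-1}B^{k}$. A solution of the problem means a feasible vector attaining the maximum.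
   Formalization: The formal theorem adds the hypothesis that B* has no zero entry; without it the objective is unbounded on the feasible set (e.g. B = 0, n ≥ 2, where B* = I), so no maximum exists and the claim fails. *)

theory Defs
  imports "HOL-Analysis.Analysis"
begin

text \<open>
  Max-algebra over the nonnegative reals. Matrices and vectors are ordinary \<^typ>\<open>real^'n^'m\<close> and
  \<^typ>\<open>real^'n\<close>; membership in the carrier is the separate predicates \<open>nonneg_mat\<close> and
  \<open>nonneg_vec\<close>. Inequalities between vectors are the library's entrywise order, \<^term>\<open>mat 1\<close> is
  the identity matrix and \<^term>\<open>1 :: real^'n\<close> the all-ones vector. Column vectors and row vectors
  share the type \<^typ>\<open>real^'n\<close>.
\<close>

definition nonneg_mat :: "real^'n^'m \<Rightarrow> bool" where
  "nonneg_mat A \<longleftrightarrow> (\<forall>i j. 0 \<le> A $ i $ j)"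

definition nonneg_vec :: "real^'n \<Rightarrow> bool" where
  "nonneg_vec x \<longleftrightarrow> (\<forall>i. 0 \<le> x $ i)"

definition regular :: "real^'n \<Rightarrow> bool" where
  "regular x \<longleftrightarrow> (\<forall>i. x $ i \<noteq> 0)"

definition max_mat_mult :: "real^'k^'m \<Rightarrow> real^'n^'k \<Rightarrow> real^'n^'m"  (infixl "\<otimes>\<^sub>m" 70) where
  "A \<otimes>\<^sub>m B = (\<chi> i j. MAX k. A $ i $ k * B $ k $ j)"

definition max_mat_vec :: "real^'n^'m \<Rightarrow> real^'n \<Rightarrow> real^'m"  (infixl "\<otimes>\<^sub>v" 70) where
  "A \<otimes>\<^sub>v x = (\<chi> i. MAX j. A $ i $ j * x $ j)"

text \<open>Product of a row vector with a column vector.\<close>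

definition max_row_col :: "real^'n \<Rightarrow> real^'n \<Rightarrow> real"  (infixl "\<otimes>\<^sub>r" 70) where
  "y \<otimes>\<^sub>r x = (MAX i. y $ i * x $ i)"

primrec max_mat_pow :: "real^'n^'n \<Rightarrow> nat \<Rightarrow> real^'n^'n" where
  "max_mat_pow B 0 = mat 1"
| "max_mat_pow B (Suc p) = B \<otimes>\<^sub>m max_mat_pow B p"

definition max_trace :: "real^'n^'n \<Rightarrow> real" where
  "max_trace B = (MAX k. B $ k $ k)"

definition max_Trace :: "real^'n^'n \<Rightarrow> real" where
  "max_Trace B = (MAX k\<in>{1..CARD('n)}. max_trace (max_mat_pow B k))"

definition kleene_star :: "real^'n^'n \<Rightarrow> real^'n^'n" where
  "kleene_star B = (\<chi> i j. MAX k\<in>{0..CARD('n) - 1}. max_mat_pow B k $ i $ j)"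

definition conj_mat :: "real^'n^'m \<Rightarrow> real^'m^'n" where
  "conj_mat A = (\<chi> i j. if A $ j $ i \<noteq> 0 then inverse (A $ j $ i) else 0)"

definition conj_vec :: "real^'n \<Rightarrow> real^'n" where
  "conj_vec x = (\<chi> i. if x $ i \<noteq> 0 then inverse (x $ i) else 0)"

definition max_norm_mat :: "real^'n^'m \<Rightarrow> real" where
  "max_norm_mat A = (MAX (i, j). A $ i $ j)"

definition max_norm_vec :: "real^'n \<Rightarrow> real" where
  "max_norm_vec x = (MAX j. x $ j)"

definition objective :: "real^'n \<Rightarrow> real" where
  "objective x = conj_vec x \<otimes>\<^sub>r 1"

definition feasible :: "real^'n^'n \<Rightarrow> (real^'n) set" where
  "feasible B = {x. nonneg_vec x \<and> regular x \<and> B \<otimes>\<^sub>v x \<le> x \<and> 1 \<otimes>\<^sub>r x = 1}"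

definition solutions :: "real^'n^'n \<Rightarrow> (real^'n) set" where
  "solutions B = {x. is_arg_max objective (\<lambda>y. y \<in> feasible B) x}"

definition star_col :: "real^'n^'n \<Rightarrow> 'n \<Rightarrow> real^'n" where
  "star_col B k = column k (kleene_star B)"

definition normalized_star_cols :: "real^'n^'n \<Rightarrow> (real^'n) set" where
  "normalized_star_cols B =
     {inverse (max_norm_vec (star_col B k)) *\<^sub>R star_col B k | k.
        is_arg_max (\<lambda>j. max_norm_vec (star_col B j) * max_norm_vec (conj_vec (star_col B j)))
          (\<lambda>_. True) k}"

definition is_minimal_solution :: "real^'n^'n \<Rightarrow> real^'n \<Rightarrow> bool" where
  "is_minimal_solution B x0 \<longleftrightarrow> x0 \<in> solutions B \<and> (\<forall>x\<in>solutions B. x0 \<le> x)"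

text \<open>
  If \<open>Tr(B) \<le> 1\<close> and \<open>B\<^sup>*\<close> has a zero entry, the objective is unbounded on the feasible set, so that no maximum
  exists. The zero matrix of order at least two, for which \<open>B\<^sup>*\<close> is the identity, shows this.
\<close>

lemma max_Trace_zero: "max_Trace (0 :: real^'n^'n) \<le> 1"
proof -
  have "max_trace (max_mat_pow (0 :: real^'n^'n) k) \<le> 1" if "k \<ge> 1" for k
    using that by (cases k) (simp_all add: max_trace_def max_mat_mult_def)
  then show ?thesis
    by (simp add: max_Trace_def)
qed

lemma objective_unbounded_zero:
  assumes "CARD('n) \<ge> 2"
  shows "\<exists>x\<in>feasible (0 :: real^'n^'n). objective x > M"
proof -
  obtain a b :: 'n where ab: "a \<noteq> b"
    using assms by (metis card_le_Suc0_iff_eq finite_class.finite_UNIV not_less_eq_eq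
        numeral_2_eq_2)
  define e where "e = inverse (\<bar>M\<bar> + 1)"
  have e: "0 < e" "e \<le> 1" by (auto simp: e_def field_simps)
  define x :: "real^'n" where "x = (\<chi> i. if i = a then 1 else e)"
  have "1 \<otimes>\<^sub>r x = 1"
    unfolding max_row_col_def using e by (intro Max_eqI) (auto simp: x_def intro!: image_eqI[of _ _ a])
  moreover have "(0 :: real^'n^'n) \<otimes>\<^sub>v x \<le> x"
    using e by (auto simp: less_eq_vec_def max_mat_vec_def x_def)
  ultimately have "x \<in> feasible 0"
    using e by (auto simp: feasible_def nonneg_vec_def regular_def x_def)
  moreover have "conj_vec x $ b * 1 $ b \<le> objective x"
    unfolding objective_def max_row_col_def by (intro Max_ge) auto
  then have "\<bar>M\<bar> + 1 \<le> objective x"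
    using ab e by (simp add: conj_vec_def x_def e_def)
  ultimately show ?thesis by force
qed

end

theory Submission
  imports Defs
begin

text \<open>
  A walk on \<open>n + 1\<close> vertices repeats a vertex, and the closed walk between the repetitions has
  weight at most \<open>Tr(B) \<le> 1\<close>. Hence \<open>B\<^sup>n \<le> B\<^sup>*\<close> and \<open>B B\<^sup>* \<le> B\<^sup>*\<close>, so every normalized column of
  \<open>B\<^sup>*\<close> is feasible, with objective value \<open>\<parallel>b\<^sub>k\<parallel> \<parallel>b\<^sub>k\<^sup>-\<parallel>\<close>; the maximum of these values is
  \<open>\<parallel>B\<^sup>* (B\<^sup>*)\<^sup>-\<parallel>\<close>. Conversely, a feasible \<open>x\<close> satisfies \<open>B\<^sup>* x \<le> x\<close>. If \<open>x\<^sub>k = 1\<close> is its largest entry,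
  then \<open>b\<^sub>k \<le> x\<close>, and \<open>\<parallel>b\<^sub>k\<parallel> = 1\<close> because the diagonal of \<open>B\<^sup>*\<close> is at least 1. The objective at
  \<open>x\<close> is therefore at most \<open>\<parallel>b\<^sub>k\<parallel> \<parallel>b\<^sub>k\<^sup>-\<parallel>\<close>, and if \<open>x\<close> is optimal, then \<open>k\<close> is a maximizing index
  and \<open>x\<close> dominates its normalized column \<open>b\<^sub>k\<close>.
\<close>

section \<open>Maxima over a finite index type\<close>

lemma Max_range_ge:
  fixes f :: "'a::finite \<Rightarrow> real"
  shows "f a \<le> (MAX x. f x)"
  by (intro Max_ge) auto

lemma Max_range_attained:
  fixes f :: "'a::finite \<Rightarrow> real"
  obtains a where "(MAX x. f x) = f a"
proof -
  have "Max (range f) \<in> range f" by (rule Max_in) auto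
  with that show thesis by blast
qed

lemma Max_range_le_iff:
  fixes f :: "'a::finite \<Rightarrow> real"
  shows "(MAX x. f x) \<le> c \<longleftrightarrow> (\<forall>a. f a \<le> c)"
  by (subst Max_le_iff) auto

subsection \<open>Walks and powers\<close>

text \<open>The list holds the vertices of a walk, so \<open>i # l\<close> has
  \<open>length l\<close> edges. A single vertex has weight 1, in accordance with the diagonal of
  \<open>B^0 = I\<close>.\<close>

fun walk_weight :: "real^'n^'n \<Rightarrow> 'n list \<Rightarrow> real" where
  "walk_weight B (i # j # l) = B $ i $ j * walk_weight B (j # l)"
| "walk_weight B _ = 1"

lemma walk_weight_nonneg: "nonneg_mat B \<Longrightarrow> 0 \<le> walk_weight B l"
  by (induction B l rule: walk_weight.induct) (auto simp: nonneg_mat_def)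

text \<open>The cut vertex \<open>y\<close> occurs in both factors, so that each edge is counted
  exactly once.\<close>

lemma walk_weight_append:
  "walk_weight B (l @ y # m) = walk_weight B (l @ [y]) * walk_weight B (y # m)"
  by (induction B l rule: walk_weight.induct) (cases m; simp)+

lemma max_mat_pow_nonneg:
  assumes "nonneg_mat B"
  shows "0 \<le> max_mat_pow B k $ i $ j"
proof (induction k arbitrary: i)
  case 0
  then show ?case by (simp add: mat_def)
next
  case (Suc k)
  have "0 \<le> B $ i $ i * max_mat_pow B k $ i $ j"
    using assms Suc by (simp add: nonneg_mat_def)
  also have "\<dots> \<le> max_mat_pow B (Suc k) $ i $ j"
    by (simp add: max_mat_mult_def Max_range_ge[where f = "\<lambda>l. B $ i $ l * max_mat_pow B k $ l $ j"])
  finally show ?case .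
qed

lemma max_mat_pow_Suc_ge:
  "B $ i $ l * max_mat_pow B k $ l $ j \<le> max_mat_pow B (Suc k) $ i $ j"
  by (simp add: max_mat_mult_def Max_range_ge[where f = "\<lambda>l. B $ i $ l * max_mat_pow B k $ l $ j"])

lemma walk_weight_le_pow:
  assumes "nonneg_mat B"
  shows "walk_weight B (i # l) \<le> max_mat_pow B (length l) $ i $ last (i # l)"
proof (induction l arbitrary: i)
  case Nil
  then show ?case by (simp add: mat_def)
next
  case (Cons j l)
  have "walk_weight B (i # j # l) \<le> B $ i $ j * max_mat_pow B (length l) $ j $ last (j # l)"
    using Cons assms by (simp add: nonneg_mat_def mult_left_mono del: last.simps)
  also have "\<dots> \<le> max_mat_pow B (Suc (length l)) $ i $ last (j # l)"
    by (rule max_mat_pow_Suc_ge)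
  finally show ?case by simp
qed

text \<open>Unfolding the powers, a maximizing index at each factor supplies the next vertex. The
  entry has to be nonzero because an off-diagonal zero of \<open>B^0\<close> comes from no walk
  without edges.\<close>

lemma pow_eq_walk_weight:
  assumes "max_mat_pow B k $ i $ j \<noteq> 0"
  obtains l where "length l = k" "last (i # l) = j" "max_mat_pow B k $ i $ j = walk_weight B (i # l)"
proof -
  have "\<exists>l. length l = k \<and> last (i # l) = j \<and> max_mat_pow B k $ i $ j = walk_weight B (i # l)"
    using assms
  proof (induction k arbitrary: i)
    case 0
    then show ?case by (simp add: mat_def split: if_splits)
  next
    case (Suc k)
    obtain m where m: "max_mat_pow B (Suc k) $ i $ j = B $ i $ m * max_mat_pow B k $ m $ j"
      using Max_range_attained[of "\<lambda>m. B $ i $ m * max_mat_pow B k $ m $ j"]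
      by (auto simp: max_mat_mult_def)
    with Suc.prems have "max_mat_pow B k $ m $ j \<noteq> 0" by auto
    from Suc.IH[OF this] obtain l where
      "length l = k" "last (m # l) = j" "max_mat_pow B k $ m $ j = walk_weight B (m # l)"
      by blast
    with m show ?case by (intro exI[of _ "m # l"]) simp
  qed
  with that show thesis by blast
qed

subsection \<open>The Kleene star\<close>

lemma pow_le_kleene_star:
  fixes B :: "real^'n^'n"
  assumes "k < CARD('n)"
  shows "max_mat_pow B k $ i $ j \<le> kleene_star B $ i $ j"
  unfolding kleene_star_def using assms by (auto intro!: Max_ge)

lemma kleene_star_attained:
  fixes B :: "real^'n^'n"
  obtains k where "k < CARD('n)" "kleene_star B $ i $ j = max_mat_pow B k $ i $ j"
proof -
  have "kleene_star B $ i $ j \<in> (\<lambda>k. max_mat_pow B k $ i $ j) ` {0..CARD('n) - 1}"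
    unfolding kleene_star_def by (simp only: vec_lambda_beta) (rule Max_in, auto)
  then obtain k where k: "k \<in> {0..CARD('n) - 1}" "kleene_star B $ i $ j = max_mat_pow B k $ i $ j"
    by auto
  \<comment> \<open>Positivity keeps the truncated subtraction in \<open>CARD('n) - 1\<close>
    harmless.\<close>
  moreover have "0 < CARD('n)" by simp
  ultimately have "k < CARD('n)" by (simp only: atLeastAtMost_iff) linarith
  with k that show thesis by blast
qed

lemma kleene_star_nonneg: "nonneg_mat B \<Longrightarrow> 0 \<le> kleene_star B $ i $ j"
  by (rule kleene_star_attained[of B i j]) (simp add: max_mat_pow_nonneg)

lemma kleene_star_diag_ge_1: "1 \<le> kleene_star B $ i $ i"
  using pow_le_kleene_star[of 0 B i i] by (simp add: mat_def)

lemma pow_diag_le_1: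
  fixes B :: "real^'n^'n"
  assumes "max_Trace B \<le> 1" "1 \<le> k" "k \<le> CARD('n)"
  shows "max_mat_pow B k $ i $ i \<le> 1"
proof -
  have "max_mat_pow B k $ i $ i \<le> max_trace (max_mat_pow B k)"
    unfolding max_trace_def by (rule Max_range_ge)
  also have "\<dots> \<le> max_Trace B"
    unfolding max_Trace_def using assms by (intro Max_ge) auto
  finally show ?thesis using assms by simp
qed

lemma pow_card_le_kleene_star:
  fixes B :: "real^'n^'n"
  assumes B: "nonneg_mat B" and Tr: "max_Trace B \<le> 1"
  shows "max_mat_pow B CARD('n) $ i $ j \<le> kleene_star B $ i $ j"
proof (cases "max_mat_pow B CARD('n) $ i $ j = 0")
  case True
  then show ?thesis using B by (simp add: kleene_star_nonneg)
next
  case False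
  then obtain l where l: "length l = CARD('n)" "last (i # l) = j"
    "max_mat_pow B CARD('n) $ i $ j = walk_weight B (i # l)"
    by (rule pow_eq_walk_weight)
  \<comment> \<open>The walk lists \<open>CARD('n) + 1\<close> vertices, so two of them
    coincide.\<close>
  have "card (set (i # l)) \<le> CARD('n)" by (intro card_mono) auto
  then have "\<not> distinct (i # l)" using l(1) distinct_card[of "i # l"] by force
  then obtain xs ys zs y where dec: "i # l = xs @ [y] @ ys @ [y] @ zs"
    using not_distinct_decomp by blast
  \<comment> \<open>The cycle through \<open>y\<close> thus has between 1 and
    \<open>CARD('n)\<close> edges, the range covered by \<open>max_Trace\<close>, and the walk
    without it has fewer than \<open>CARD('n)\<close>.\<close>
  have len: "length xs + length ys + length zs + 1 = CARD('n)"
    using arg_cong[OF dec, of length] l(1) by simp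
  have "walk_weight B (y # ys @ [y]) \<le> max_mat_pow B (Suc (length ys)) $ y $ y"
    using walk_weight_le_pow[OF B, of y "ys @ [y]"] by simp
  also have "\<dots> \<le> 1" using len by (intro pow_diag_le_1[OF Tr]) auto
  finally have cycle: "walk_weight B (y # ys @ [y]) \<le> 1" .
  have "walk_weight B (i # l) =
      walk_weight B (xs @ [y]) * (walk_weight B (y # ys @ [y]) * walk_weight B (y # zs))"
    using walk_weight_append[of B xs y "ys @ y # zs"] walk_weight_append[of B "y # ys" y zs]
    by (simp add: dec)
  also have "\<dots> \<le> walk_weight B (xs @ [y]) * walk_weight B (y # zs)"
    using cycle walk_weight_nonneg[OF B] by (intro mult_left_mono mult_left_le_one_le) auto
  also have "\<dots> = walk_weight B (xs @ y # zs)" by (simp add: walk_weight_append[of B xs y zs])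
  also have "\<dots> \<le> max_mat_pow B (length xs + length zs) $ i $ j"
  proof -
    \<comment> \<open>The shortened walk still starts at \<open>i\<close>: if \<open>xs\<close> is
      empty, then \<open>y\<close> is \<open>i\<close>.\<close>
    obtain l' where l': "xs @ y # zs = i # l'" using dec by (cases xs) auto
    have "last (i # l') = j" using l(2) by (simp only: dec flip: l') simp
    moreover have "length l' = length xs + length zs" using arg_cong[OF l', of length] by simp
    ultimately show ?thesis using walk_weight_le_pow[OF B, of i l'] by (simp only: l')
  qed
  also have "\<dots> \<le> kleene_star B $ i $ j" using len by (intro pow_le_kleene_star) simp
  finally show ?thesis by (simp add: l(3))
qed

lemma mult_kleene_star_le:
  fixes B :: "real^'n^'n"
  assumes B: "nonneg_mat B" and Tr: "max_Trace B \<le> 1"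
  shows "B $ i $ l * kleene_star B $ l $ j \<le> kleene_star B $ i $ j"
proof -
  obtain k where k: "k < CARD('n)" "kleene_star B $ l $ j = max_mat_pow B k $ l $ j"
    by (rule kleene_star_attained)
  have "B $ i $ l * kleene_star B $ l $ j \<le> max_mat_pow B (Suc k) $ i $ j"
    unfolding k(2) by (rule max_mat_pow_Suc_ge)
  also have "\<dots> \<le> kleene_star B $ i $ j"
  \<comment> \<open>Only \<open>k = CARD('n) - 1\<close> leads out of the powers that form the star;
    there the cycle removal applies.\<close>
  proof (cases "Suc k = CARD('n)")
    case True
    then show ?thesis using pow_card_le_kleene_star[OF B Tr, of i j] by simp
  next
    case False
    then show ?thesis using k(1) by (intro pow_le_kleene_star) simp
  qed
  finally show ?thesis .
qed

lemma max_mat_vec_le_iff: "A \<otimes>\<^sub>v x \<le> y \<longleftrightarrow> (\<forall>i j. A $ i $ j * x $ j \<le> y $ i)"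
  by (auto simp: less_eq_vec_def max_mat_vec_def Max_range_le_iff)

text \<open>Iterating \<open>B x \<le> x\<close> gives \<open>B^k x \<le> x\<close>. For
  \<open>k = 0\<close> the off-diagonal entries require \<open>0 \<le> x\<close>.\<close>

lemma pow_subeigenvector:
  assumes B: "nonneg_mat B" and x: "nonneg_vec x" "B \<otimes>\<^sub>v x \<le> x"
  shows "max_mat_pow B k $ i $ j * x $ j \<le> x $ i"
proof (induction k arbitrary: i)
  case 0
  then show ?case using x(1) by (simp add: mat_def nonneg_vec_def)
next
  case (Suc k)
  obtain m where m: "max_mat_pow B (Suc k) $ i $ j = B $ i $ m * max_mat_pow B k $ m $ j"
    using Max_range_attained[of "\<lambda>m. B $ i $ m * max_mat_pow B k $ m $ j"]
    by (auto simp: max_mat_mult_def)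
  have "max_mat_pow B (Suc k) $ i $ j * x $ j \<le> B $ i $ m * x $ m"
    using Suc[of m] B unfolding m by (simp add: nonneg_mat_def mult.assoc mult_left_mono)
  also have "\<dots> \<le> x $ i" using x(2) by (simp add: max_mat_vec_le_iff)
  finally show ?case .
qed

lemma kleene_star_subeigenvector:
  assumes "nonneg_mat B" "nonneg_vec x" "B \<otimes>\<^sub>v x \<le> x"
  shows "kleene_star B $ i $ j * x $ j \<le> x $ i"
  by (rule kleene_star_attained[of B i j]) (simp add: pow_subeigenvector[OF assms])

subsection \<open>The optimization problem\<close>

lemma objective_regular: "regular x \<Longrightarrow> objective x = (MAX i. inverse (x $ i))"
  by (simp add: objective_def max_row_col_def conj_vec_def regular_def)

context
  fixes B :: "real^'n^'n"
  assumes B: "nonneg_mat B" and Tr: "max_Trace B \<le> 1"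
    and nonzero: "\<forall>i j. kleene_star B $ i $ j \<noteq> 0"
begin

text \<open>Positivity makes the columns of the star regular and their conjugates plain entrywise
  inverses.\<close>

lemma star_pos: "0 < kleene_star B $ i $ j"
  using kleene_star_nonneg[OF B, of i j] nonzero by (simp add: less_le)

lemma star_col_nth: "star_col B k $ i = kleene_star B $ i $ k"
  by (simp add: star_col_def column_def)

text \<open>For a positive column this is the ratio of its largest to its smallest entry.\<close>

abbreviation col_spread :: "'n \<Rightarrow> real" where
  "col_spread k \<equiv> max_norm_vec (star_col B k) * max_norm_vec (conj_vec (star_col B k))"

lemma norm_star_col: "max_norm_vec (star_col B k) = (MAX i. kleene_star B $ i $ k)"
  by (simp add: max_norm_vec_def star_col_nth)

lemma norm_conj_star_col: "max_norm_vec (conj_vec (star_col B k)) = (MAX i. inverse (kleene_star B $ i $ k))"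
  by (simp add: max_norm_vec_def star_col_nth conj_vec_def nonzero)

lemma norm_star_col_ge_1: "1 \<le> max_norm_vec (star_col B k)"
  unfolding norm_star_col
  using kleene_star_diag_ge_1[of B k] Max_range_ge[of "\<lambda>i. kleene_star B $ i $ k" k] by linarith

lemma norm_conj_star_col_pos: "0 < max_norm_vec (conj_vec (star_col B k))"
  unfolding norm_conj_star_col
  using star_pos[of k k] Max_range_ge[of "\<lambda>i. inverse (kleene_star B $ i $ k)" k]
  by (meson inverse_positive_iff_positive less_le_trans)

text \<open>Both sides are the maximum of the ratios \<open>S_ik / S_jk\<close> over all
  \<open>i\<close>, \<open>j\<close>, \<open>k\<close>, taken in different orders. Comparing their
  upper bounds \<open>c\<close> avoids rearranging nested maxima.\<close>

lemma norm_star_conj_star: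
  "max_norm_mat (kleene_star B \<otimes>\<^sub>m conj_mat (kleene_star B)) = (MAX k. col_spread k)"
proof -
  let ?S = "kleene_star B"
  have entry: "(?S \<otimes>\<^sub>m conj_mat ?S) $ i $ j = (MAX k. ?S $ i $ k * inverse (?S $ j $ k))" for i j
    by (simp add: max_mat_mult_def conj_mat_def nonzero)
  have norm: "max_norm_mat (?S \<otimes>\<^sub>m conj_mat ?S) \<le> c \<longleftrightarrow>
      (\<forall>i j k. ?S $ i $ k * inverse (?S $ j $ k) \<le> c)" for c
    unfolding max_norm_mat_def
    by (subst Max_le_iff) (auto simp: entry Max_range_le_iff)
  have spread: "col_spread k \<le> c \<longleftrightarrow> (\<forall>i j. ?S $ i $ k * inverse (?S $ j $ k) \<le> c)" for k c
  proof
    assume c: "col_spread k \<le> c"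
    show "\<forall>i j. ?S $ i $ k * inverse (?S $ j $ k) \<le> c"
    proof (intro allI)
      fix i j
      have "?S $ i $ k * inverse (?S $ j $ k) \<le> col_spread k"
        unfolding norm_star_col norm_conj_star_col
        using star_pos[of j k] norm_star_col_ge_1[of k, unfolded norm_star_col]
        by (intro mult_mono Max_range_ge[where f = "\<lambda>i. ?S $ i $ k"]
            Max_range_ge[where f = "\<lambda>i. inverse (?S $ i $ k)"]) auto
      with c show "?S $ i $ k * inverse (?S $ j $ k) \<le> c" by simp
    qed
  next
    assume "\<forall>i j. ?S $ i $ k * inverse (?S $ j $ k) \<le> c"
    moreover obtain i where "max_norm_vec (star_col B k) = ?S $ i $ k"
      unfolding norm_star_col by (rule Max_range_attained)
    moreover obtain j where "max_norm_vec (conj_vec (star_col B k)) = inverse (?S $ j $ k)"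
      unfolding norm_conj_star_col by (rule Max_range_attained)
    ultimately show "col_spread k \<le> c" by simp
  qed
  have "max_norm_mat (?S \<otimes>\<^sub>m conj_mat ?S) \<le> c \<longleftrightarrow> (MAX k. col_spread k) \<le> c" for c
    unfolding norm Max_range_le_iff spread by blast
  then show ?thesis by (meson order.refl order.antisym)
qed

section \<open>Normalized columns and their place among the feasible vectors\<close>

abbreviation normalized_col :: "'n \<Rightarrow> real^'n" where
  "normalized_col k \<equiv> inverse (max_norm_vec (star_col B k)) *\<^sub>R star_col B k"

lemma normalized_col_feasible: "normalized_col k \<in> feasible B"
proof -
  let ?c = "max_norm_vec (star_col B k)"
  have c: "0 < ?c" using norm_star_col_ge_1[of k] by simp
  have "B $ i $ j * normalized_col k $ j \<le> normalized_col k $ i" for i j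
    using mult_left_mono[OF mult_kleene_star_le[OF B Tr, of i j k], of "inverse ?c"] c
    by (simp add: star_col_nth mult_ac)
  moreover have "1 \<otimes>\<^sub>r normalized_col k = 1"
    unfolding max_row_col_def
  proof (rule Max_eqI)
    fix y assume "y \<in> range (\<lambda>i. (1::real^'n) $ i * normalized_col k $ i)"
    then obtain i where y: "y = inverse ?c * kleene_star B $ i $ k" by (auto simp: star_col_nth)
    have "kleene_star B $ i $ k \<le> ?c"
      unfolding norm_star_col by (rule Max_range_ge)
    with c show "y \<le> 1" by (simp add: y field_simps)
  next
    obtain i where "?c = kleene_star B $ i $ k"
      unfolding norm_star_col by (rule Max_range_attained)
    with c show "1 \<in> range (\<lambda>i. (1::real^'n) $ i * normalized_col k $ i)"
      by (intro image_eqI[of _ _ i]) (auto simp: star_col_nth)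
  qed simp
  ultimately show ?thesis
    using c star_pos
    by (auto simp: feasible_def max_mat_vec_le_iff nonneg_vec_def regular_def star_col_nth
        less_imp_le less_imp_neq[symmetric])
qed

text \<open>Conjugation turns the factor \<open>inverse ?c\<close> into \<open>?c\<close>, which is
  nonnegative and can be moved out of the maximum.\<close>

lemma objective_normalized_col: "objective (normalized_col k) = col_spread k"
proof -
  let ?c = "max_norm_vec (star_col B k)"
  have c: "0 \<le> ?c" using norm_star_col_ge_1[of k] by simp
  have "regular (normalized_col k)" using normalized_col_feasible by (simp add: feasible_def)
  then have "objective (normalized_col k) = (MAX i. ?c * inverse (kleene_star B $ i $ k))"
    by (simp add: objective_regular star_col_nth)
  also have "\<dots> = ?c * (MAX i. inverse (kleene_star B $ i $ k))"
    using mono_Max_commute[of "\<lambda>y. ?c * y" "range (\<lambda>i. inverse (kleene_star B $ i $ k))"] c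
    by (simp add: mono_def mult_left_mono image_image)
  finally show ?thesis by (simp add: norm_conj_star_col)
qed

text \<open>One index \<open>k\<close> serves both conclusions: for an optimal \<open>x\<close> the
  second makes \<open>k\<close> a maximizing index, and the first then places \<open>x\<close> above
  a vector of the claimed set.\<close>

lemma feasible_above_normalized_col:
  assumes x: "x \<in> feasible B"
  obtains k where "normalized_col k \<le> x" "objective x \<le> col_spread k"
proof -
  have nn: "nonneg_vec x" and reg: "regular x" and sub: "B \<otimes>\<^sub>v x \<le> x" and one: "(MAX i. x $ i) = 1"
    using x by (auto simp: feasible_def max_row_col_def)
  obtain k where k: "x $ k = 1" using one by (metis Max_range_attained)
  have col: "kleene_star B $ i $ k \<le> x $ i" for i
    using kleene_star_subeigenvector[OF B nn sub, of i k] k by simp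
  moreover have "x $ i \<le> 1" for i
    using Max_range_ge[of "\<lambda>i. x $ i" i] one by simp
  ultimately have "max_norm_vec (star_col B k) \<le> 1"
    unfolding norm_star_col Max_range_le_iff by (meson order.trans)
  \<comment> \<open>The column lies below \<open>x\<close>, whose entries are at most 1, and its
    diagonal entry is at least 1, so it is already normalized.\<close>
  with norm_star_col_ge_1[of k] have norm: "max_norm_vec (star_col B k) = 1" by simp
  have "normalized_col k \<le> x" by (simp add: norm less_eq_vec_def star_col_nth col)
  moreover have "inverse (x $ i) \<le> col_spread k" for i
  proof -
    have "inverse (x $ i) \<le> inverse (kleene_star B $ i $ k)"
      using col star_pos by (intro le_imp_inverse_le)
    also have "\<dots> \<le> col_spread k"
      unfolding norm norm_conj_star_col using Max_range_ge[of "\<lambda>i. inverse (kleene_star B $ i $ k)" i]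
      by simp
    finally show ?thesis .
  qed
  then have "objective x \<le> col_spread k" by (simp add: objective_regular[OF reg] Max_range_le_iff)
  ultimately show thesis by (rule that)
qed

section \<open>Maximizing columns, solutions and the least solution\<close>

lemma is_arg_max_col_spread_iff:
  "is_arg_max col_spread (\<lambda>_. True) k \<longleftrightarrow> col_spread k = (MAX j. col_spread j)"
proof -
  have "is_arg_max col_spread (\<lambda>_. True) k \<longleftrightarrow> (MAX j. col_spread j) \<le> col_spread k"
    unfolding Max_range_le_iff by (simp add: is_arg_max_linorder)
  moreover have "col_spread k \<le> (MAX j. col_spread j)" by (rule Max_range_ge)
  ultimately show ?thesis by linarith
qed

lemma normalized_star_cols_alt:
  "normalized_star_cols B = {normalized_col k | k. col_spread k = (MAX j. col_spread j)}"
  by (simp add: normalized_star_cols_def is_arg_max_col_spread_iff)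

lemma objective_feasible_le: "x \<in> feasible B \<Longrightarrow> objective x \<le> (MAX j. col_spread j)"
  by (metis feasible_above_normalized_col Max_range_ge order.trans)

lemma maximum_attained:
  obtains k where "normalized_col k \<in> normalized_star_cols B"
    "objective (normalized_col k) = (MAX j. col_spread j)"
proof -
  obtain k where "(MAX j. col_spread j) = col_spread k" by (rule Max_range_attained)
  then show thesis using that[of k] by (auto simp: normalized_star_cols_alt objective_normalized_col)
qed

lemma solutions_iff: "x \<in> solutions B \<longleftrightarrow> x \<in> feasible B \<and> objective x = (MAX j. col_spread j)"
proof
  assume sol: "x \<in> solutions B"
  obtain k where "objective (normalized_col k) = (MAX j. col_spread j)"
    by (rule maximum_attained)
  then have "(MAX j. col_spread j) \<le> objective x" "x \<in> feasible B"
    using sol normalized_col_feasible[of k] by (auto simp: solutions_def is_arg_max_linorder)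
  with objective_feasible_le[of x] show "x \<in> feasible B \<and> objective x = (MAX j. col_spread j)" by auto
next
  assume "x \<in> feasible B \<and> objective x = (MAX j. col_spread j)"
  then show "x \<in> solutions B"
    using objective_feasible_le by (auto simp: solutions_def is_arg_max_linorder)
qed

lemma normalized_star_cols_solutions: "normalized_star_cols B \<subseteq> solutions B"
  using normalized_col_feasible by (auto simp: normalized_star_cols_alt solutions_iff objective_normalized_col)

lemma solution_above_normalized_star_col:
  assumes "x \<in> solutions B"
  shows "\<exists>v\<in>normalized_star_cols B. v \<le> x"
proof -
  have x: "x \<in> feasible B" "objective x = (MAX j. col_spread j)"
    using assms by (auto simp: solutions_iff)
  obtain k where k: "normalized_col k \<le> x" "objective x \<le> col_spread k"
    using feasible_above_normalized_col[OF x(1)] .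
  have "col_spread k = (MAX j. col_spread j)"
    using k(2) unfolding x(2) by (rule order.antisym[OF Max_range_ge])
  with k(1) show ?thesis by (auto simp: normalized_star_cols_alt)
qed

text \<open>The maximizing columns are themselves solutions and lie below all solutions, so a least
  solution is the same as a least element among these columns.\<close>

lemma is_minimal_solution_iff:
  "is_minimal_solution B x0 \<longleftrightarrow> x0 \<in> normalized_star_cols B \<and> (\<forall>w\<in>normalized_star_cols B. x0 \<le> w)"
proof
  assume min: "is_minimal_solution B x0"
  then obtain v where v: "v \<in> normalized_star_cols B" "v \<le> x0"
    using solution_above_normalized_star_col by (auto simp: is_minimal_solution_def)
  moreover have "\<forall>w\<in>normalized_star_cols B. x0 \<le> w"
    using min normalized_star_cols_solutions by (auto simp: is_minimal_solution_def)
  ultimately show "x0 \<in> normalized_star_cols B \<and> (\<forall>w\<in>normalized_star_cols B. x0 \<le> w)"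
    \<comment> \<open>The column \<open>v\<close> below \<open>x0\<close> is also above it, hence
      \<open>x0 = v\<close>.\<close>
    by (metis order.antisym)
next
  assume "x0 \<in> normalized_star_cols B \<and> (\<forall>w\<in>normalized_star_cols B. x0 \<le> w)"
  then show "is_minimal_solution B x0"
    using solution_above_normalized_star_col normalized_star_cols_solutions
    unfolding is_minimal_solution_def by (meson order.trans subsetD)
qed

end

theorem lemma7:
  fixes B :: "real^'n^'n"
  assumes B_nonneg: "nonneg_mat B"
    and Tr_le_1: "max_Trace B \<le> 1"
    and star_no_zero_entry: "\<forall>i j. kleene_star B $ i $ j \<noteq> 0"
  shows "(\<exists>x\<in>feasible B. objective x = max_norm_mat (kleene_star B \<otimes>\<^sub>m conj_mat (kleene_star B)))
    \<and> (\<forall>x\<in>feasible B. objective x \<le> max_norm_mat (kleene_star B \<otimes>\<^sub>m conj_mat (kleene_star B)))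
    \<and> normalized_star_cols B \<subseteq> solutions B
    \<and> (\<forall>x\<in>solutions B. \<exists>v\<in>normalized_star_cols B. v \<le> x)
    \<and> (\<forall>v\<in>normalized_star_cols B.
         (\<forall>w\<in>normalized_star_cols B - {v}. v \<le> w) \<or> normalized_star_cols B = {v} \<longrightarrow>
         (\<forall>x0. is_minimal_solution B x0 \<longleftrightarrow> x0 = v))
    \<and> (\<not> (\<exists>v\<in>normalized_star_cols B.
            (\<forall>w\<in>normalized_star_cols B - {v}. v \<le> w) \<or> normalized_star_cols B = {v}) \<longrightarrow>
         \<not> (\<exists>x0. is_minimal_solution B x0))"
proof -
  note assms = B_nonneg Tr_le_1 star_no_zero_entry
  \<comment> \<open>By reflexivity, both alternatives amount to \<open>v\<close> being the least
    element of \<open>N\<close>; in the singleton case there is nothing else to compare.\<close>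
  have least: "(\<forall>w\<in>N - {v}. v \<le> w) \<or> N = {v} \<longleftrightarrow> (\<forall>w\<in>N. v \<le> w)"
    if "v \<in> N" for v :: "real^'n" and N
    using that by auto
  show ?thesis
  proof (intro conjI)
    show "\<exists>x\<in>feasible B. objective x = max_norm_mat (kleene_star B \<otimes>\<^sub>m conj_mat (kleene_star B))"
      using maximum_attained[OF assms] normalized_col_feasible[OF assms]
      unfolding norm_star_conj_star[OF assms] by metis
    show "\<forall>x\<in>feasible B. objective x \<le> max_norm_mat (kleene_star B \<otimes>\<^sub>m conj_mat (kleene_star B))"
      using objective_feasible_le[OF assms] by (simp add: norm_star_conj_star[OF assms])
    show "normalized_star_cols B \<subseteq> solutions B"
      by (rule normalized_star_cols_solutions[OF assms])
    show "\<forall>x\<in>solutions B. \<exists>v\<in>normalized_star_cols B. v \<le> x"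
      using solution_above_normalized_star_col[OF assms] by blast
    show "\<forall>v\<in>normalized_star_cols B.
         (\<forall>w\<in>normalized_star_cols B - {v}. v \<le> w) \<or> normalized_star_cols B = {v} \<longrightarrow>
         (\<forall>x0. is_minimal_solution B x0 \<longleftrightarrow> x0 = v)"
      by (metis least is_minimal_solution_iff[OF assms] order.antisym)
    show "\<not> (\<exists>v\<in>normalized_star_cols B.
            (\<forall>w\<in>normalized_star_cols B - {v}. v \<le> w) \<or> normalized_star_cols B = {v}) \<longrightarrow>
         \<not> (\<exists>x0. is_minimal_solution B x0)"
      by (metis least is_minimal_solution_iff[OF assms])
  qed
qed

end
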